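(* For every finite simple gammoid $M$, $$\sum_{L \in \mathcal{L}(M)} (|L|-2) \leq |E(M)| - r(M),$$ where $\mathcal{L}(M)$ is the set of long lines of $M$, that is, the set of rank-two flats of $M$ with at least three elements.
   Context: All matroids and directed graphs are finite. $E(M)$ is the ground set and $r(M)$ the rank of a matroid $M$. A matroid is simple if it has no loops and no parallel pairs. A flat is a set equal to its own closure. Gammoids: let $D$ be a finite directed graph and let $T, E \subseteq V(D)$. A set $I \subseteq E$ is linkable to $T$ if there are pairwise vertex-disjoint directed paths in $D$ whose initial vertices are exactly the elements of $I$ and whose terminal vertices lie in $T$ (paths of length zero are allowed). The subsets of $E$ linkable to $T$ are the independent sets of a matroid on $E$; a matroid arising in this way is called a gammoid. *)

theory Defs
  imports "Graph_Theory.Digraph" "Graph_Theory.Vertex_Walk"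
begin

record 'a independence_system =
  ground :: "'a set"
  indep :: "'a set \<Rightarrow> bool"

locale matroid =
  fixes M :: "'a independence_system" (structure)
  assumes finite_ground: "finite (ground M)"
    and indep_subset_ground: "indep M X \<Longrightarrow> X \<subseteq> ground M"
    and indep_empty: "indep M {}"
    and indep_subset: "indep M X \<Longrightarrow> Y \<subseteq> X \<Longrightarrow> indep M Y"
    and augmentation: "indep M X \<Longrightarrow> indep M Y \<Longrightarrow> card X < card Y
      \<Longrightarrow> \<exists>e \<in> Y - X. indep M (insert e X)"

definition rank_of :: "'a independence_system \<Rightarrow> 'a set \<Rightarrow> nat" where
  "rank_of M X = Max (card ` {I. I \<subseteq> X \<and> indep M I})"

definition rank :: "'a independence_system \<Rightarrow> nat" where
  "rank M = rank_of M (ground M)"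

definition cl :: "'a independence_system \<Rightarrow> 'a set \<Rightarrow> 'a set" where
  "cl M X = {e \<in> ground M. rank_of M (insert e X) = rank_of M X}"

definition flat :: "'a independence_system \<Rightarrow> 'a set \<Rightarrow> bool" where
  "flat M F \<longleftrightarrow> F \<subseteq> ground M \<and> cl M F = F"

definition is_loop :: "'a independence_system \<Rightarrow> 'a \<Rightarrow> bool" where
  "is_loop M e \<longleftrightarrow> e \<in> ground M \<and> \<not> indep M {e}"

definition parallel_pair :: "'a independence_system \<Rightarrow> 'a \<Rightarrow> 'a \<Rightarrow> bool" where
  "parallel_pair M e f \<longleftrightarrow> e \<in> ground M \<and> f \<in> ground M \<and> e \<noteq> f
    \<and> \<not> is_loop M e \<and> \<not> is_loop M f \<and> \<not> indep M {e, f}"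

definition simple_matroid :: "'a independence_system \<Rightarrow> bool" where
  "simple_matroid M \<longleftrightarrow> matroid M \<and> (\<nexists>e. is_loop M e) \<and> (\<nexists>e f. parallel_pair M e f)"

definition long_lines :: "'a independence_system \<Rightarrow> 'a set set" where
  "long_lines M = {L. flat M L \<and> rank_of M L = 2 \<and> 3 \<le> card L}"

text \<open>
  Paths are nonempty lists of distinct vertices, so a one-element list is a path of length
  zero. Disjointness makes the initial vertices of the paths in the family distinct.
\<close>
definition linkable :: "('a, 'b) pre_digraph \<Rightarrow> 'a set \<Rightarrow> 'a set \<Rightarrow> bool" where
  "linkable D T I \<longleftrightarrow>
    (\<exists>P. (\<forall>p \<in> P. vpath p D \<and> last p \<in> T)
       \<and> pairwise (\<lambda>p q. disjnt (set p) (set q)) P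
       \<and> hd ` P = I)"

text \<open>
  The presentation (the digraph \<open>D\<close> and the set \<open>T\<close>) is a parameter rather than existentially
  quantified, so that no type has to be chosen for the vertices of \<open>D\<close> outside the ground
  set; a theorem assuming \<open>gammoid M D T\<close> holds for every \<open>M\<close> that has such a presentation.
\<close>
locale gammoid = matroid M + fin_digraph D
  for M :: "'a independence_system" and D :: "('a, 'b) pre_digraph" +
  fixes T :: "'a set"
  assumes targets_subset: "T \<subseteq> verts D"
    and ground_subset: "ground M \<subseteq> verts D"
    and indep_iff: "indep M I \<longleftrightarrow> I \<subseteq> ground M \<and> linkable D T I"

end

(*
  For a vertex set Y let the boundary of Y consist of the vertices of Y that lie in T or have an
  arc leaving Y. Every linkage from inside Y uses distinct boundary vertices, so r(X) is at most
  |boundary Y| whenever X is contained in Y, and by Menger's theorem equality holds for some such Y.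
  The number |boundary Y| is submodular in Y.

  For each element e take a maximal set Q(e) containing e with one boundary vertex s(e), and for
  each long line L a maximal set Y(L) containing L with two boundary vertices. Submodularity gives
  that s is injective, that s(L) is contained in Y(L), and that for distinct lines L, L' no vertex
  common to s(L) and s(L') is interior to both Y(L) and Y(L'). At least |L| - 2 vertices of s(L)
  are interior to Y(L), and these are not in the boundary of the union X of all Q(e) and Y(L).
  Comparing r(M) <= |boundary X| with |s(E)| = |E| gives the inequality: an element of boundary
  Y(L) outside s(L) is compensated by one further interior vertex in s(L).
*)
theory Submission
  imports Defs "HOL-Library.Disjoint_Sets"
begin

section \<open>Boundaries of vertex sets and their submodularity\<close>

definition exits :: "('a \<times> 'a) set \<Rightarrow> 'a set \<Rightarrow> 'a set \<Rightarrow> 'a set" where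
  "exits R T Y = {v \<in> Y. v \<in> T \<or> (\<exists>w. (v, w) \<in> R \<and> w \<notin> Y)}"

lemma exits_subset: "exits R T Y \<subseteq> Y"
  by (auto simp: exits_def)

lemma finite_exits:
  assumes "finite R" and "finite T"
  shows "finite (exits R T Y)"
  by (rule finite_subset[of _ "T \<union> Domain R"]) (use assms in \<open>auto simp: exits_def finite_Domain\<close>)

lemma exits_Un_subset: "exits R T (A \<union> B) \<subseteq> exits R T A \<union> exits R T B"
  by (auto simp: exits_def)

text \<open>The two boundaries on the left have their union inside
  \<open>exits R T A \<union> exits R T B\<close> and their intersection inside
  \<open>exits R T A \<inter> exits R T B\<close>.\<close>

lemma card_exits_submodular:
  assumes "finite R" and "finite T"
  shows "card (exits R T (A \<union> B)) + card (exits R T (A \<inter> B))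
    \<le> card (exits R T A) + card (exits R T B)"
proof -
  let ?S = "exits R T"
  have fin: "finite (?S Y)" for Y
    by (rule finite_exits[OF assms])
  have "card (?S (A \<union> B)) + card (?S (A \<inter> B))
      = card (?S (A \<union> B) \<union> ?S (A \<inter> B)) + card (?S (A \<union> B) \<inter> ?S (A \<inter> B))"
    by (rule card_Un_Int) (rule fin)+
  also have "\<dots> \<le> card (?S A \<union> ?S B) + card (?S A \<inter> ?S B)"
    by (intro add_mono card_mono) (use fin in \<open>auto simp: exits_def\<close>)
  also have "\<dots> = card (?S A) + card (?S B)"
    by (rule card_Un_Int[symmetric]) (rule fin)+
  finally show ?thesis .
qed

section \<open>Linkages as families of disjoint vertex sets\<close>

text \<open>The paths are recorded only through pairwise disjoint vertex sets \<open>U a\<close> inside which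
  \<open>a\<close> reaches \<open>f a\<close>; this makes paths easy to restrict and to concatenate.\<close>
definition linkage ::
    "('a \<times> 'a) set \<Rightarrow> 'a set \<Rightarrow> 'a set \<Rightarrow> 'a set \<Rightarrow> ('a \<Rightarrow> 'a set) \<Rightarrow> ('a \<Rightarrow> 'a) \<Rightarrow> bool" where
  "linkage R A B I U f \<longleftrightarrow> finite I \<and> I \<subseteq> A \<and> disjoint_family_on U I
    \<and> (\<forall>a\<in>I. f a \<in> B \<and> (a, f a) \<in> rtrancl_on (U a) R)"

lemma rtrancl_on_mono:
  assumes "(a, b) \<in> rtrancl_on F R" and "F \<subseteq> F'" and "R \<subseteq> R'"
  shows "(a, b) \<in> rtrancl_on F' R'"
  using assms(1)
proof (induction rule: rtrancl_on_induct)
  case base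
  then show ?case using assms(2) by auto
next
  case (step y z)
  then show ?case using assms(2,3) rtrancl_on_into_rtrancl_on by (metis subsetD)
qed

lemma linkage_mono:
  assumes "linkage R A B I U f" and "R \<subseteq> R'"
  shows "linkage R' A B I U f"
  using assms(1) rtrancl_on_mono[OF _ subset_refl assms(2)] by (simp add: linkage_def)

lemma linkage_inj_on:
  assumes "linkage R A B I U f"
  shows "inj_on f I"
proof (rule inj_onI)
  fix a b assume "a \<in> I" "b \<in> I" "f a = f b"
  then have "f a \<in> U a \<inter> U b"
    using assms in_rtrancl_on_in_F(2) unfolding linkage_def by (metis IntI)
  then show "a = b"
    using assms \<open>a \<in> I\<close> \<open>b \<in> I\<close> unfolding linkage_def disjoint_family_on_def by blast
qed

text \<open>By counting, the injective \<open>f\<close> is onto \<open>B\<close>. Each end lies in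
  the set of its own path, so disjointness keeps the other ends out of \<open>U a\<close>.\<close>

lemma linkage_onto_Int:
  assumes "linkage R A B I U f" and "finite B" and "card B \<le> card I" and "a \<in> I"
  shows "U a \<inter> B = {f a}"
proof -
  have "f ` I \<subseteq> B"
    using assms(1) by (auto simp: linkage_def)
  then have "f ` I = B"
    using assms(2,3) card_image[OF linkage_inj_on[OF assms(1)]] by (intro card_seteq) auto
  moreover have self: "f b \<in> U b" if "b \<in> I" for b
    using assms(1) that in_rtrancl_on_in_F(2) unfolding linkage_def by metis
  moreover have "b = a" if "b \<in> I" "f b \<in> U a" for b
    using disjoint_family_onD[of U I b a] assms(1,4) that self[OF that(1)]
    by (auto simp: linkage_def)
  ultimately show ?thesis
    using assms(4) by auto
qed

text \<open>The counterpart at the initial vertices: counting forces every vertex of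
  \<open>A\<close> to be used.\<close>

lemma linkage_from_Int:
  assumes "linkage R A B I U f" and "finite A" and "card A \<le> card I" and "a \<in> A"
  shows "I = A" and "U a \<inter> A = {a}"
proof -
  show *: "I = A"
    using assms by (intro card_seteq) (auto simp: linkage_def)
  moreover have self: "b \<in> U b" if "b \<in> I" for b
    using assms(1) that in_rtrancl_on_in_F(1) unfolding linkage_def by metis
  moreover have "b = a" if "b \<in> I" "a \<in> I" "b \<in> U a" for b
    using disjoint_family_onD[of U I b a] assms(1) that self[OF that(1)]
    by (auto simp: linkage_def)
  ultimately show "U a \<inter> A = {a}"
    using assms(4) by auto
qed

section \<open>Cutting paths at a boundary; Menger's theorem\<close>

text \<open>A path can leave \<open>Y\<close> only from an exit, and only \<open>b\<close> is
  available, so \<open>b\<close> is reached before the first departure.\<close>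

lemma rtrancl_on_restrict_until_exit:
  assumes "(a, b) \<in> rtrancl_on U R" and "a \<in> Y" and "U \<inter> exits R T Y \<subseteq> {b}" and "b \<in> Y"
  shows "(a, b) \<in> rtrancl_on (U \<inter> Y) R"
proof -
  have "(z \<in> Y \<and> (a, z) \<in> rtrancl_on (U \<inter> Y) R) \<or> (a, b) \<in> rtrancl_on (U \<inter> Y) R"
    if "(a, z) \<in> rtrancl_on U R" for z
    using that
  proof (induction rule: rtrancl_on_induct)
    case base
    then show ?case using assms by auto
  next
    case (step y z)
    show ?case
    proof (cases "z \<in> Y")
      case True
      then show ?thesis using step by (auto intro: rtrancl_on_into_rtrancl_on)
    next
      case False
      then show ?thesis using step assms(3) by (auto simp: exits_def)
    qed
  qed
  from this[OF assms(1)] show ?thesis by blast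
qed

text \<open>Read backwards, the path can enter \<open>Y\<close> only at an exit, hence at
  \<open>a\<close>. If \<open>b\<close> itself is in \<open>Y\<close>, then \<open>b \<in> T\<close>
  makes it an exit, so \<open>b = a\<close>.\<close>

lemma rtrancl_on_restrict_after_exit:
  assumes "(a, b) \<in> rtrancl_on U R" and "b \<in> T" and "U \<inter> exits R T Y \<subseteq> {a}"
  shows "(a, b) \<in> rtrancl_on (insert a (U - Y)) R"
proof -
  let ?W = "insert a (U - Y)"
  have "(z \<in> ?W \<and> (z, b) \<in> rtrancl_on ?W R) \<or> (a, b) \<in> rtrancl_on ?W R"
    if "(z, b) \<in> rtrancl_on U R" for z
    using that
  proof (induction rule: converse_rtrancl_on_induct)
    case base
    then show ?case using assms by (auto simp: exits_def)
  next
    case (step x y)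
    show ?case
    proof (cases "x \<in> ?W")
      case True
      then show ?thesis using step by (auto intro: converse_rtrancl_on_into_rtrancl_on)
    next
      case False
      then show ?thesis using step assms(3) by (auto simp: exits_def)
    qed
  qed
  from this[OF assms(1)] show ?thesis by blast
qed

text \<open>Menger's theorem. If deleting the arc \<open>(x, y)\<close> destroys the separation hypothesis, a
  tight set \<open>Y\<^sub>0\<close> witnesses this; linkages into and out of its exits, which exist
  by induction, are then glued along \<open>(x, y)\<close>.\<close>
theorem menger:
  assumes "finite R" and "finite T" and "\<And>Y. A \<subseteq> Y \<Longrightarrow> k \<le> card (exits R T Y)"
  shows "\<exists>I U f. linkage R A T I U f \<and> card I = k"
  using assms
proof (induction R arbitrary: A T rule: finite_induct)
  case empty
  have "k \<le> card (A \<inter> T)"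
    using empty.prems(2)[of A] by (simp add: exits_def Int_def)
  then obtain I where "I \<subseteq> A \<inter> T" "card I = k" "finite I"
    by (rule obtain_subset_with_card_n)
  then have "linkage {} A T I (\<lambda>a. {a}) (\<lambda>a. a)"
    by (auto simp: linkage_def disjoint_family_on_def)
  then show ?case using \<open>card I = k\<close> by blast
next
  case (insert e R)
  obtain x y where e: "e = (x, y)" by fastforce
  have fin: "finite (exits R T Y)" for Y
    by (rule finite_exits[OF insert.hyps(1) insert.prems(1)])
  show ?case
  proof (cases "\<forall>Y. A \<subseteq> Y \<longrightarrow> k \<le> card (exits R T Y)")
    case True
    then obtain I U f where "linkage R A T I U f" "card I = k"
      using insert.IH[OF insert.prems(1)] by blast
    moreover from this(1) have "linkage (insert e R) A T I U f"
      by (rule linkage_mono) (rule subset_insertI)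
    ultimately show ?thesis by blast
  next
    case False
    then obtain Y0 where Y0: "A \<subseteq> Y0" "card (exits R T Y0) < k"
      by (meson not_le)
    let ?S = "exits R T Y0"
    have xy: "x \<in> Y0" "y \<notin> Y0"
    proof -
      have "exits (insert e R) T Y0 \<noteq> ?S"
        using insert.prems(2)[OF Y0(1)] Y0(2) by auto
      then show "x \<in> Y0" "y \<notin> Y0" by (auto simp: exits_def e)
    qed
    \<comment> \<open>\<open>?P\<close> is the boundary of \<open>Y0\<close> with the arc present;
      \<open>?Q\<close> replaces its tail \<open>x\<close> by its head \<open>y\<close>. Both turn
      out to have exactly \<open>k\<close> elements.\<close>
    let ?P = "insert x ?S" and ?Q = "insert y ?S"
    have "exits (insert e R) T Y0 = ?P"
      using xy by (auto simp: exits_def e)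
    then have cardP: "card ?P = k" and xS: "x \<notin> ?S"
      using insert.prems(2)[OF Y0(1)] Y0(2) fin[of Y0] card_insert_if[OF fin[of Y0], of x]
      by (auto split: if_splits)
    have yS: "y \<notin> ?S" using xy(2) by (auto simp: exits_def)
    have cardQ: "card ?Q = k"
      using cardP xS yS fin[of Y0] by simp
    \<comment> \<open>The hypothesis is applied to \<open>Y \<inter> Y0\<close>: every exit of that
      set lies in \<open>?P\<close> or leaves \<open>Y\<close> along an arc of
      \<open>R\<close>.\<close>
    have "k \<le> card (exits R ?P Y)" if "A \<subseteq> Y" for Y
    proof -
      have "k \<le> card (exits (insert e R) T (Y \<inter> Y0))"
        by (rule insert.prems(2)) (use that Y0(1) in auto)
      also have "\<dots> \<le> card (exits R ?P Y)"
        by (rule card_mono, rule finite_exits)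
          (use insert.hyps(1) fin in \<open>auto simp: exits_def e\<close>)
      finally show ?thesis .
    qed
    then obtain I1 U1 f1 where L1: "linkage R A ?P I1 U1 f1" and c1: "card I1 = k"
      using insert.IH[of ?P A] fin by blast
    \<comment> \<open>The hypothesis is applied to \<open>Y \<union> Y0\<close>: since
      \<open>?Q \<subseteq> Y\<close>, neither the arc \<open>(x, y)\<close> nor a vertex of
      \<open>Y0 - Y\<close> produces an exit.\<close>
    have "k \<le> card (exits R T Y)" if "?Q \<subseteq> Y" for Y
    proof -
      have "k \<le> card (exits (insert e R) T (Y \<union> Y0))"
        by (rule insert.prems(2)) (use Y0(1) in auto)
      also have "\<dots> \<le> card (exits R T Y)"
        by (rule card_mono, rule fin) (use that in \<open>auto simp: exits_def e\<close>)
      finally show ?thesis .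
    qed
    then obtain I2 U2 f2 where L2': "linkage R ?Q T I2 U2 f2" and c2: "card I2 = k"
      using insert.IH[OF insert.prems(1), of ?Q] by blast
    have "I2 = ?Q"
      using L2' c2 cardQ fin[of Y0] linkage_from_Int(1) by (metis finite_insert insertI1 order_refl)
    with L2' have L2: "linkage R ?Q T ?Q U2 f2" by simp
    \<comment> \<open>A path ending at \<open>x\<close> crosses the arc to \<open>y\<close>; any
      other continues from its end. Trimming first pieces to \<open>Y0\<close> and second pieces to
      its complement prevents the two kinds from meeting.\<close>
    define g where "g p = (if p = x then y else p)" for p
    define U where "U a = (U1 a \<inter> Y0) \<union> (U2 (g (f1 a)) - Y0)" for a
    have f1P: "f1 a \<in> ?P" if "a \<in> I1" for a
      using L1 that by (auto simp: linkage_def)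
    have gQ: "g (f1 a) \<in> ?Q" if "a \<in> I1" for a
      using f1P[OF that] by (auto simp: g_def)
    have "inj_on g ?P"
      using yS by (auto simp: inj_on_def g_def)
    then have "inj_on (g \<circ> f1) I1"
      by (intro comp_inj_on linkage_inj_on[OF L1], elim inj_on_subset) (use f1P in auto)
    then have inj: "g (f1 a) \<noteq> g (f1 b)" if "a \<in> I1" "b \<in> I1" "a \<noteq> b" for a b
      using that by (metis comp_apply inj_onD)
    have disj: "disjoint_family_on U I1"
      unfolding disjoint_family_on_def
    proof (intro ballI impI)
      fix a b assume ab: "a \<in> I1" "b \<in> I1" "a \<noteq> b"
      have "U1 a \<inter> U1 b = {}"
        using L1 ab by (simp add: linkage_def disjoint_family_on_def)
      moreover have "U2 (g (f1 a)) \<inter> U2 (g (f1 b)) = {}"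
        using L2 disjoint_family_onD[OF _ gQ[OF ab(1)] gQ[OF ab(2)] inj[OF ab], of U2]
        unfolding linkage_def by blast
      ultimately show "U a \<inter> U b = {}"
        unfolding U_def by blast
    qed
    have "f2 (g (f1 a)) \<in> T \<and> (a, f2 (g (f1 a))) \<in> rtrancl_on (U a) (insert e R)" if a: "a \<in> I1" for a
    proof
      let ?p = "f1 a" and ?q = "g (f1 a)"
      show f2T: "f2 ?q \<in> T" using L2 gQ[OF a] by (auto simp: linkage_def)
      have "(a, ?p) \<in> rtrancl_on (U1 a \<inter> Y0) R"
      proof (rule rtrancl_on_restrict_until_exit)
        show "(a, ?p) \<in> rtrancl_on (U1 a) R" "a \<in> Y0"
          using L1 a Y0(1) by (auto simp: linkage_def)
        show "U1 a \<inter> exits R T Y0 \<subseteq> {?p}"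
          using linkage_onto_Int[OF L1 _ _ a] fin[of Y0] cardP c1 by auto
        show "?p \<in> Y0"
          using f1P[OF a] xy(1) by (auto simp: exits_def)
      qed
      then have 1: "(a, ?p) \<in> rtrancl_on (U a) (insert e R)"
        by (rule rtrancl_on_mono) (auto simp: U_def)
      then have pU: "?p \<in> U a"
        by (rule in_rtrancl_on_in_F)
      have "U2 ?q \<inter> ?Q = {?q}"
        using linkage_from_Int(2)[OF L2 _ _ gQ[OF a]] fin[of Y0] by auto
      moreover have "(?q, f2 ?q) \<in> rtrancl_on (U2 ?q) R"
        using L2 gQ[OF a] by (auto simp: linkage_def)
      ultimately have tail: "(?q, f2 ?q) \<in> rtrancl_on (insert ?q (U2 ?q - Y0)) R"
        using f2T by (intro rtrancl_on_restrict_after_exit[of _ _ _ _ T]) auto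
      \<comment> \<open>If trimming removes \<open>?q\<close> from the second piece, then
        \<open>?q = ?p\<close>, which the first piece supplies.\<close>
      have qU: "?q \<in> U a"
      proof (cases "?p = x")
        case True
        then show ?thesis
          using \<open>U2 ?q \<inter> ?Q = {?q}\<close> xy(2) by (auto simp: U_def g_def)
      qed (use pU in \<open>simp add: g_def\<close>)
      then have "(?q, f2 ?q) \<in> rtrancl_on (U a) (insert e R)"
        by (intro rtrancl_on_mono[OF tail]) (auto simp: U_def)
      moreover have "(?p, ?q) \<in> rtrancl_on (U a) (insert e R)"
        using pU qU by (auto simp: g_def e intro: rtrancl_on_into_rtrancl_on[OF rtrancl_on_refl])
      ultimately show "(a, f2 ?q) \<in> rtrancl_on (U a) (insert e R)"
        by (intro rtrancl_on_trans[OF 1 rtrancl_on_trans])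
    qed
    then have "linkage (insert e R) A T I1 U (\<lambda>a. f2 (g (f1 a)))"
      using L1 disj unfolding linkage_def by simp
    then show ?thesis using c1 by blast
  qed
qed

section \<open>From linkages to directed paths and back to boundaries\<close>

lemma rtrancl_on_imp_vwalk:
  assumes "(a, b) \<in> rtrancl_on (U \<inter> verts D) (arcs_ends D)"
  shows "\<exists>p. vwalk p D \<and> hd p = a \<and> last p = b \<and> set p \<subseteq> U"
  using assms
proof (induction rule: converse_rtrancl_on_induct)
  case base
  then show ?case by (intro exI[of _ "[b]"]) auto
next
  case (step x y)
  then obtain p where p: "vwalk p D" "hd p = y" "last p = b" "set p \<subseteq> U" by blast
  then have "vwalk (x # p) D" using step by (intro vwalk_consI) auto
  moreover have "p \<noteq> []" using p(1) by auto
  ultimately show ?case using p step by (intro exI[of _ "x # p"]) auto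
qed

text \<open>Shortening a walk inside \<open>U a\<close> to a path keeps both ends and adds no
  vertex, so disjointness survives.\<close>

lemma (in wf_digraph) linkage_imp_linkable:
  assumes "linkage (arcs_ends G) A T I U f" and "A \<subseteq> verts G"
  shows "linkable G T I"
proof -
  have "\<exists>p. vpath p G \<and> hd p = a \<and> last p \<in> T \<and> set p \<subseteq> U a" if a: "a \<in> I" for a
  proof -
    \<comment> \<open>\<open>U a\<close> may contain elements that are not vertices, but ends of
      arcs always are vertices.\<close>
    have restrict: "(a, z) \<in> rtrancl_on (U a \<inter> verts G) (arcs_ends G)"
      if "(a, z) \<in> rtrancl_on (U a) (arcs_ends G)" for z
      using that
    proof (induction rule: rtrancl_on_induct)
      case base
      then show ?case using assms a by (auto simp: linkage_def)
    next
      case (step y z)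
      then show ?case
        by (auto intro!: rtrancl_on_into_rtrancl_on[of a y] adj_in_verts)
    qed
    obtain p where p: "vwalk p G" "hd p = a" "last p = f a" "set p \<subseteq> U a"
      using rtrancl_on_imp_vwalk[OF restrict[of "f a"]] assms(1) a by (auto simp: linkage_def)
    then show ?thesis
      using assms(1) a vwalk_to_vpath_vpath[OF p(1)] vwalk_to_vpath_hd[of p]
        vwalk_to_vpath_last[of p] vwalk_to_vpath_subset[of _ p]
      by (intro exI[of _ "vwalk_to_vpath p"]) (auto simp: linkage_def)
  qed
  then obtain p where p: "\<And>a. a \<in> I \<Longrightarrow> vpath (p a) G \<and> hd (p a) = a \<and> last (p a) \<in> T \<and> set (p a) \<subseteq> U a"
    by metis
  have "pairwise (\<lambda>p q. disjnt (set p) (set q)) (p ` I)"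
  proof (rule pairwiseI)
    fix q q' assume "q \<in> p ` I" "q' \<in> p ` I" "q \<noteq> q'"
    then obtain a b where "a \<in> I" "b \<in> I" "a \<noteq> b" "q = p a" "q' = p b" by auto
    then show "disjnt (set q) (set q')"
      using p[of a] p[of b] assms(1) unfolding linkage_def disjoint_family_on_def disjnt_def
      by blast
  qed
  moreover have "hd ` p ` I = I"
    using p by (force simp: image_image)
  ultimately show ?thesis
    unfolding linkable_def using p by (intro exI[of _ "p ` I"]) auto
qed

lemma vwalk_meets_exits:
  assumes "vwalk p D" and "hd p \<in> Y" and "last p \<in> T"
  shows "set p \<inter> exits (arcs_ends D) T Y \<noteq> {}"
  using assms
proof induction
  case (Base u)
  then show ?case by (auto simp: exits_def)
next
  case (Cons u v es)
  show ?case
  proof (cases "v \<in> Y")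
    case True
    then show ?thesis using Cons by auto
  next
    case False
    then show ?thesis using Cons by (auto simp: exits_def)
  qed
qed

text \<open>The easy half of Menger's theorem: each path meets the boundary, and disjoint paths meet
  it in different vertices.\<close>

lemma linkable_card_le_exits:
  assumes "linkable D T I" and "I \<subseteq> Y" and "finite (exits (arcs_ends D) T Y)"
  shows "card I \<le> card (exits (arcs_ends D) T Y)"
proof -
  obtain P where P: "\<And>p. p \<in> P \<Longrightarrow> vpath p D \<and> last p \<in> T"
      "pairwise (\<lambda>p q. disjnt (set p) (set q)) P" "hd ` P = I"
    using assms(1) unfolding linkable_def by blast
  have "\<exists>p v. p \<in> P \<and> hd p = i \<and> v \<in> set p \<and> v \<in> exits (arcs_ends D) T Y" if i: "i \<in> I" for i
  proof -
    obtain p where p: "p \<in> P" "hd p = i" using P(3) i by auto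
    then show ?thesis
      using vwalk_meets_exits[of p D Y T] P(1)[of p] i assms(2) by (auto elim: vpathE)
  qed
  then obtain p v where pv: "\<And>i. i \<in> I \<Longrightarrow>
      p i \<in> P \<and> hd (p i) = i \<and> v i \<in> set (p i) \<and> v i \<in> exits (arcs_ends D) T Y"
    by metis
  have "inj_on v I"
  proof (rule inj_onI)
    fix i j assume ij: "i \<in> I" "j \<in> I" "v i = v j"
    then have "\<not> disjnt (set (p i)) (set (p j))"
      using pv by (metis disjnt_iff)
    then have "p i = p j"
      using P(2) pv ij unfolding pairwise_def by blast
    then show "i = j" using pv ij by metis
  qed
  then show ?thesis
    using pv assms(3) by (intro card_inj_on_le[of v]) auto
qed

section \<open>Rank, flats and long lines of a matroid\<close>

context matroid
begin

lemma finite_indep_subsets: "finite {I. I \<subseteq> X \<and> indep M I}"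
  by (rule finite_subset[of _ "Pow (ground M)"])
    (use finite_ground indep_subset_ground in auto)

lemma card_indep_le_rank_of:
  assumes "I \<subseteq> X" and "indep M I"
  shows "card I \<le> rank_of M X"
  unfolding rank_of_def using assms finite_indep_subsets by (intro Max_ge) auto

lemma rank_of_attained:
  obtains I where "I \<subseteq> X" and "indep M I" and "card I = rank_of M X"
proof -
  have "rank_of M X \<in> card ` {I. I \<subseteq> X \<and> indep M I}"
    unfolding rank_of_def by (rule Max_in) (use finite_indep_subsets indep_empty in auto)
  then show thesis using that by auto
qed

lemma rank_of_mono:
  assumes "X \<subseteq> Y"
  shows "rank_of M X \<le> rank_of M Y"
  by (rule rank_of_attained[of X]) (metis assms card_indep_le_rank_of subset_trans)

lemma flat_subset_flat:
  assumes "flat M F" and "F' \<subseteq> ground M" and "rank_of M (F \<union> F') \<le> rank_of M F"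
  shows "F' \<subseteq> F"
proof
  fix e assume "e \<in> F'"
  then have "rank_of M (insert e F) = rank_of M F"
    using rank_of_mono[of "insert e F" "F \<union> F'"] rank_of_mono[of F "insert e F"] assms(3)
    by (simp add: subset_insertI)
  then show "e \<in> F"
    using assms(1,2) \<open>e \<in> F'\<close> unfolding flat_def cl_def by blast
qed

text \<open>If the union had rank two, each line, being a flat, would contain the other.\<close>

lemma rank_of_Un_long_lines:
  assumes "L \<in> long_lines M" and "L' \<in> long_lines M" and "L \<noteq> L'"
  shows "3 \<le> rank_of M (L \<union> L')"
proof (rule ccontr)
  assume "\<not> 3 \<le> rank_of M (L \<union> L')"
  then have "L' \<subseteq> L" "L \<subseteq> L'"
    using assms flat_subset_flat[of L L'] flat_subset_flat[of L' L]
    by (auto simp: long_lines_def flat_def Un_commute)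
  then show False using assms(3) by blast
qed

text \<open>The case \<open>e = f\<close> is included and gives independence of singletons.\<close>

lemma simple_indep_pair:
  assumes "simple_matroid M" and "e \<in> ground M" and "f \<in> ground M"
  shows "indep M {e, f}"
  using assms unfolding simple_matroid_def parallel_pair_def is_loop_def
  by (cases "e = f") auto

end

section \<open>The rank in a gammoid as a minimum boundary size\<close>

context gammoid
begin

abbreviation boundary :: "'a set \<Rightarrow> 'a set" where
  "boundary \<equiv> exits (arcs_ends D) T"

lemma finite_targets: "finite T"
  using targets_subset finite_verts by (rule finite_subset)

lemma finite_arcs_ends: "finite (arcs_ends D)"
  by (simp add: arcs_ends_def)

lemma finite_boundary: "finite (boundary Y)"
  by (rule finite_exits[OF finite_arcs_ends finite_targets])

lemma card_boundary_submodular: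
  "card (boundary (A \<union> B)) + card (boundary (A \<inter> B)) \<le> card (boundary A) + card (boundary B)"
  by (rule card_exits_submodular[OF finite_arcs_ends finite_targets])

lemma rank_of_le_card_boundary:
  assumes "X \<subseteq> Y"
  shows "rank_of M X \<le> card (boundary Y)"
proof -
  obtain I where "I \<subseteq> X" "indep M I" "card I = rank_of M X"
    by (rule rank_of_attained)
  then show ?thesis
    using linkable_card_le_exits[of D T I Y] indep_iff[of I] finite_boundary assms by auto
qed

text \<open>Otherwise Menger's theorem would link \<open>rank_of M X + 1\<close> elements of
  \<open>X\<close>. Staying inside \<open>verts D\<close> permits a maximal choice later.\<close>

lemma rank_of_eq_card_boundary:
  assumes "X \<subseteq> ground M"
  obtains Y where "X \<subseteq> Y" and "Y \<subseteq> verts D" and "card (boundary Y) = rank_of M X"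
proof -
  have "\<exists>Y. X \<subseteq> Y \<and> card (boundary Y) \<le> rank_of M X"
  proof (rule ccontr)
    assume "\<not> ?thesis"
    then have "Suc (rank_of M X) \<le> card (boundary Y)" if "X \<subseteq> Y" for Y
      using that not_less_eq_eq by blast
    from menger[OF finite_arcs_ends finite_targets this]
    obtain I U f where I: "linkage (arcs_ends D) X T I U f" "card I = Suc (rank_of M X)"
      by blast
    then have "I \<subseteq> X" by (simp add: linkage_def)
    moreover have "linkable D T I"
      using linkage_imp_linkable[OF I(1)] assms ground_subset by auto
    ultimately show False
      using card_indep_le_rank_of[of I X] indep_iff[of I] I(2) assms by auto
  qed
  then obtain Y where Y: "X \<subseteq> Y" "card (boundary Y) \<le> rank_of M X" by blast
  \<comment> \<open>Heads of arcs lie in \<open>verts D\<close>, so the intersection creates no new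
    exits.\<close>
  have "boundary (Y \<inter> verts D) \<subseteq> boundary Y"
    by (auto simp: exits_def adj_in_verts)
  then have "card (boundary (Y \<inter> verts D)) \<le> rank_of M X"
    using Y(2) card_mono[OF finite_boundary] order_trans by blast
  moreover have "X \<subseteq> Y \<inter> verts D"
    using Y(1) assms ground_subset by auto
  ultimately show thesis
    using that[of "Y \<inter> verts D"] rank_of_le_card_boundary[of X "Y \<inter> verts D"] by auto
qed

section \<open>Maximal sets of bounded boundary and the inequality for long lines\<close>

definition saturated :: "nat \<Rightarrow> 'a set \<Rightarrow> bool" where
  "saturated k Y \<longleftrightarrow> Y \<subseteq> verts D \<and> card (boundary Y) \<le> k
    \<and> (\<forall>Z. Y \<subseteq> Z \<longrightarrow> Z \<subseteq> verts D \<longrightarrow> card (boundary Z) \<le> k \<longrightarrow> Z = Y)"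

lemma ex_saturated_superset:
  assumes "X \<subseteq> verts D" and "card (boundary X) \<le> k"
  shows "\<exists>Y. X \<subseteq> Y \<and> saturated k Y"
proof -
  let ?F = "{Y. Y \<subseteq> verts D \<and> card (boundary Y) \<le> k}"
  have "finite ?F" by simp
  then obtain Y where "Y \<in> ?F" "X \<subseteq> Y" "\<forall>Z\<in>?F. Y \<subseteq> Z \<longrightarrow> Y = Z"
    using finite_has_maximal2[of ?F X] assms by blast
  then show ?thesis unfolding saturated_def by (intro exI[of _ Y]) auto
qed

lemma saturated_absorb:
  assumes "saturated k Y" and "Z \<subseteq> verts D" and "card (boundary (Y \<union> Z)) \<le> k"
  shows "Z \<subseteq> Y"
  using assms unfolding saturated_def by (metis Un_least Un_upper1 Un_upper2)

lemma sum_long_lines_le: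
  assumes "simple_matroid M"
  shows "(\<Sum>L \<in> long_lines M. int (card L) - 2) \<le> int (card (ground M)) - int (rank M)"
proof -
  let ?E = "ground M" and ?\<L> = "long_lines M"
  have "\<exists>Q. e \<in> Q \<and> saturated 1 Q" if "e \<in> ?E" for e
  proof -
    have "card (boundary {e}) \<le> 1"
      using card_mono[OF _ exits_subset[of "arcs_ends D" T "{e}"]] by simp
    then show ?thesis
      using ex_saturated_superset[of "{e}" 1] that ground_subset by auto
  qed
  then obtain Q where Q: "\<And>e. e \<in> ?E \<Longrightarrow> e \<in> Q e" "\<And>e. e \<in> ?E \<Longrightarrow> saturated 1 (Q e)"
    by metis
  then have Q_verts: "Q e \<subseteq> verts D" and Q_card: "card (boundary (Q e)) \<le> 1" if "e \<in> ?E" for e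
    using that unfolding saturated_def by blast+
  have boundary_ge_2: "2 \<le> card (boundary Z)" if "e \<in> ?E" "f \<in> ?E" "e \<noteq> f" "{e, f} \<subseteq> Z" for e f Z
    using card_indep_le_rank_of[OF subset_refl simple_indep_pair[OF assms that(1,2)]]
      rank_of_le_card_boundary[OF that(4)] that(3) by simp
  have boundary_ge_1: "1 \<le> card (boundary Z)" if "e \<in> ?E" "e \<in> Z" for e Z
    using card_indep_le_rank_of[OF subset_refl simple_indep_pair[OF assms that(1,1)]]
      rank_of_le_card_boundary[of "{e}" Z] that(2) by simp
  have "\<exists>v. boundary (Q e) = {v}" if "e \<in> ?E" for e
    using Q_card[OF that] boundary_ge_1[OF that Q(1)[OF that]] by (simp add: card_1_singleton_iff[symmetric])
  then obtain s where s: "\<And>e. e \<in> ?E \<Longrightarrow> boundary (Q e) = {s e}" by metis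
  have inj_s: "inj_on s ?E"
  proof (rule inj_onI, rule ccontr)
    fix e f assume *: "e \<in> ?E" "f \<in> ?E" "s e = s f" "e \<noteq> f"
    \<comment> \<open>Two elements sharing \<open>s\<close> would lie in a set with at most one
      boundary vertex, although they have rank two.\<close>
    have "boundary (Q e \<union> Q f) \<subseteq> {s e}"
      using exits_Un_subset[of "arcs_ends D" T "Q e" "Q f"] s * by auto
    then have "card (boundary (Q e \<union> Q f)) \<le> 1"
      using card_mono[of "{s e}"] by simp
    then show False
      using boundary_ge_2[of e f "Q e \<union> Q f"] * Q(1) by auto
  qed
  have line: "L \<subseteq> ?E" "rank_of M L = 2" "finite L" if "L \<in> ?\<L>" for L
    using that finite_ground finite_subset by (auto simp: long_lines_def flat_def)
  have fin_lines: "finite ?\<L>"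
    by (rule finite_subset[of _ "Pow ?E"]) (use line(1) finite_ground in auto)
  have "\<exists>Y. L \<subseteq> Y \<and> saturated 2 Y" if L: "L \<in> ?\<L>" for L
  proof -
    obtain Y where Y: "L \<subseteq> Y" "Y \<subseteq> verts D" "card (boundary Y) \<le> 2"
      using rank_of_eq_card_boundary[OF line(1)[OF L]] line(2)[OF L] by (metis order_refl)
    then show ?thesis
      using ex_saturated_superset[OF Y(2,3)] by blast
  qed
  then obtain Y where Y: "\<And>L. L \<in> ?\<L> \<Longrightarrow> L \<subseteq> Y L" "\<And>L. L \<in> ?\<L> \<Longrightarrow> saturated 2 (Y L)"
    by metis
  have Y_verts: "Y L \<subseteq> verts D" and Y_card: "card (boundary (Y L)) = 2" if "L \<in> ?\<L>" for L
    using Y(2)[OF that] rank_of_le_card_boundary[OF Y(1)[OF that]] line(2)[OF that]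
    unfolding saturated_def by auto
  have QY: "Q e \<subseteq> Y L" if "L \<in> ?\<L>" "e \<in> L" for e L
  proof -
    have e: "e \<in> ?E" using that line(1) by blast
    \<comment> \<open>Submodularity then bounds the boundary of the union by 2 + 1 - 1, so the
      maximal set \<open>Y L\<close> absorbs \<open>Q e\<close>.\<close>
    have "1 \<le> card (boundary (Y L \<inter> Q e))"
      by (rule boundary_ge_1[OF e]) (use Y(1) Q(1)[OF e] that in auto)
    then have "card (boundary (Y L \<union> Q e)) \<le> 2"
      using card_boundary_submodular[of "Y L" "Q e"] Y_card[OF that(1)] Q_card[OF e] by linarith
    then show ?thesis
      using saturated_absorb[OF Y(2)[OF that(1)] Q_verts[OF e]] by blast
  qed
  \<comment> \<open>By \<open>sY\<close> below, \<open>W L\<close> consists of vertices interior to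
    \<open>Y L\<close>.\<close>
  define W where "W L = s ` L - boundary (Y L)" for L
  have sY: "s e \<in> Y L" if "L \<in> ?\<L>" "e \<in> L" for e L
  proof -
    have "e \<in> ?E" using that line(1) by blast
    then have "s e \<in> Q e"
      using s exits_subset[of "arcs_ends D" T "Q e"] by simp
    then show ?thesis using QY[OF that] by blast
  qed
  have W_disjoint: "W L \<inter> W L' = {}" if LL: "L \<in> ?\<L>" "L' \<in> ?\<L>" "L \<noteq> L'" for L L'
  proof (rule ccontr)
    assume "W L \<inter> W L' \<noteq> {}"
    then obtain e f where ef: "e \<in> L" "f \<in> L'" "s e = s f"
        "s e \<notin> boundary (Y L)" "s e \<notin> boundary (Y L')"
      by (auto simp: W_def)
    have e: "e \<in> ?E" and "f \<in> ?E" using line(1) LL ef by blast+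
    then have "e = f" using inj_s ef(3) by (auto dest: inj_onD)
    let ?K = "Y L \<inter> Y L'"
    \<comment> \<open>Submodularity leaves at most 2 + 2 - 3 boundary vertices for
      \<open>?K\<close>, so maximality of \<open>Q e\<close> gives \<open>?K = Q e\<close>. Its
      boundary vertex \<open>s e\<close> then has to be a boundary vertex of \<open>Y L\<close> or
      of \<open>Y L'\<close>.\<close>
    have "3 \<le> card (boundary (Y L \<union> Y L'))"
      using rank_of_Un_long_lines[OF LL] rank_of_le_card_boundary[of "L \<union> L'" "Y L \<union> Y L'"]
        Y(1) LL by fastforce
    then have "card (boundary ?K) \<le> 1"
      using card_boundary_submodular[of "Y L" "Y L'"] Y_card LL by simp
    moreover have "Q e \<subseteq> ?K"
      using QY LL ef \<open>e = f\<close> by auto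
    ultimately have "?K = Q e"
      using Q(2)[OF e] Y_verts[OF LL(1)] unfolding saturated_def by blast
    then have "s e \<in> boundary ?K"
      using s[OF e] by simp
    then show False
      using ef(4,5) by (auto simp: exits_def)
  qed
  have card_W: "int (card L) - 2 = int (card (W L)) - int (card (boundary (Y L) - s ` L))"
    if L: "L \<in> ?\<L>" for L
  proof -
    have "card (s ` L) = card L"
      using inj_s line(1)[OF L] by (intro card_image) (rule inj_on_subset)
    moreover have "card (s ` L) = card (W L) + card (s ` L \<inter> boundary (Y L))"
      unfolding W_def using card_Int_Diff[of "s ` L" "boundary (Y L)"] line(3)[OF L] by simp
    moreover have "card (boundary (Y L)) = card (boundary (Y L) - s ` L) + card (s ` L \<inter> boundary (Y L))"
      using card_Int_Diff[OF finite_boundary, of "Y L" "s ` L"] by (simp add: Int_commute)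
    ultimately show ?thesis using Y_card[OF L] by simp
  qed
  define X where "X = (\<Union>e\<in>?E. Q e) \<union> (\<Union>L\<in>?\<L>. Y L)"
  have W_sub: "(\<Union>L\<in>?\<L>. W L) \<subseteq> s ` ?E"
    using line(1) by (auto simp: W_def)
  have "boundary X \<subseteq> (s ` ?E - (\<Union>L\<in>?\<L>. W L)) \<union> (\<Union>L\<in>?\<L>. boundary (Y L) - s ` L)"
  proof
    fix v assume v: "v \<in> boundary X"
    \<comment> \<open>A vertex interior to \<open>Y L\<close> stays interior in the larger set
      \<open>X\<close>.\<close>
    have not_W: "v \<notin> W L" if "L \<in> ?\<L>" for L
      using v that sY[OF that] by (auto simp: W_def X_def exits_def)
    have "v \<in> (\<Union>e\<in>?E. boundary (Q e)) \<union> (\<Union>L\<in>?\<L>. boundary (Y L))"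
      using v unfolding X_def exits_def by blast
    moreover have "s ` L \<subseteq> s ` ?E" if "L \<in> ?\<L>" for L
      using line(1)[OF that] by (rule image_mono)
    ultimately show "v \<in> (s ` ?E - (\<Union>L\<in>?\<L>. W L)) \<union> (\<Union>L\<in>?\<L>. boundary (Y L) - s ` L)"
      using not_W s by fastforce
  qed
  moreover have "?E \<subseteq> X" using Q(1) by (auto simp: X_def)
  ultimately have "rank M
      \<le> card ((s ` ?E - (\<Union>L\<in>?\<L>. W L)) \<union> (\<Union>L\<in>?\<L>. boundary (Y L) - s ` L))"
    unfolding rank_def
    by (intro order_trans[OF rank_of_le_card_boundary[of ?E X] card_mono])
      (use finite_ground fin_lines finite_boundary in auto)
  also have "\<dots> \<le> card (s ` ?E - (\<Union>L\<in>?\<L>. W L)) + (\<Sum>L\<in>?\<L>. card (boundary (Y L) - s ` L))"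
    by (intro order_trans[OF card_Un_le] add_left_mono card_UN_le fin_lines)
  finally have "int (rank M) \<le> int (card (s ` ?E - (\<Union>L\<in>?\<L>. W L)))
      + (\<Sum>L\<in>?\<L>. int (card (boundary (Y L) - s ` L)))"
    by (simp flip: of_nat_sum)
  moreover have "int (card (s ` ?E - (\<Union>L\<in>?\<L>. W L))) = int (card ?E) - (\<Sum>L\<in>?\<L>. int (card (W L)))"
  proof -
    have "card (\<Union>L\<in>?\<L>. W L) = (\<Sum>L\<in>?\<L>. card (W L))"
      using fin_lines line(3) W_disjoint by (intro card_UN_disjoint) (auto simp: W_def)
    moreover have "card (s ` ?E - (\<Union>L\<in>?\<L>. W L)) + card (\<Union>L\<in>?\<L>. W L) = card ?E"
      using card_Diff_subset[OF finite_subset[OF W_sub] W_sub] card_mono[OF _ W_sub]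
        finite_ground card_image[OF inj_s] by simp
    ultimately show ?thesis by (simp flip: of_nat_sum)
  qed
  ultimately show ?thesis
    by (simp add: card_W sum_subtractf)
qed

end

theorem proposition1p3:
  fixes M :: "'a independence_system"
    and D :: "('a, 'b) pre_digraph"
    and T :: "'a set"
  assumes "gammoid M D T"
    and "simple_matroid M"
  shows "(\<Sum>L \<in> long_lines M. int (card L) - 2) \<le> int (card (ground M)) - int (rank M)"
  using assms by (rule gammoid.sum_long_lines_le)

end
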